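(* For every odd positive integer $v>1$ there exist integers $x,y,z,\lambda$ with $0\le x,y,z<v/2$ and $\lambda\ge 0$ such that $(v;x,y,y,z;\lambda)$ is a propus parameter set, i.e. $$x(x-1)+2y(y-1)+z(z-1)=\lambda(v-1)\quad\text{and}\quad \lambda=x+2y+z-v .$$
   Context: A GS-parameter set is a tuple $(v;k_1,k_2,k_3,k_4;\lambda)$ of nonnegative integers, with $v\ge 1$, satisfying $\sum_{i=1}^4 k_i(k_i-1)=\lambda(v-1)$ and $\lambda=\sum_{i=1}^4 k_i-v$. A propus parameter set is a GS-parameter set with $k_2=k_3$; it is written $(v;x,y,y,z;\lambda)$ with $x=k_1$, $y=k_2=k_3$, $z=k_4$. *)

theory Defs
  imports Complex_Main
begin

definition GS_parameter_set :: "int \<Rightarrow> int \<Rightarrow> int \<Rightarrow> int \<Rightarrow> int \<Rightarrow> int \<Rightarrow> bool" where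
  "GS_parameter_set v k1 k2 k3 k4 l \<longleftrightarrow>
     v \<ge> 1 \<and> k1 \<ge> 0 \<and> k2 \<ge> 0 \<and> k3 \<ge> 0 \<and> k4 \<ge> 0 \<and> l \<ge> 0 \<and>
     k1 * (k1 - 1) + k2 * (k2 - 1) + k3 * (k3 - 1) + k4 * (k4 - 1) = l * (v - 1) \<and>
     l = k1 + k2 + k3 + k4 - v"

definition propus_parameter_set :: "int \<Rightarrow> int \<Rightarrow> int \<Rightarrow> int \<Rightarrow> int \<Rightarrow> int \<Rightarrow> bool" where
  "propus_parameter_set v k1 k2 k3 k4 l \<longleftrightarrow> GS_parameter_set v k1 k2 k3 k4 l \<and> k2 = k3"

end

theory Submission
  imports Defs "HOL-Analysis.Analysis" "HOL-Library.Nat_Bijection"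
begin

text \<open>
  Completing squares turns the two equations into \<open>4v = a\<^sup>2 + 2b\<^sup>2 + c\<^sup>2\<close> with \<open>a, b, c\<close> odd, that is, into
  \<open>(v - 1) / 2 = T\<^sub>i + 2 T\<^sub>j + T\<^sub>k\<close> with triangular numbers \<open>T\<^sub>n = n (n + 1) / 2\<close>. Such a representation exists
  for every natural number iff all coefficients of \<open>\<psi>(q)\<^sup>2 \<psi>(q\<^sup>2)\<close> are positive, where
  \<open>\<psi>(q) = \<Sum>\<^sub>n q\<^bsup>T(n)\<^esup>\<close>. This can be read off from the Hecke-type expansion
  \<open>\<psi>(q)\<^sup>2 \<psi>(q\<^sup>2) = \<Sum>\<^sub>r q\<^bsup>2r(r+1)\<^esup> (1 + q\<^bsup>2r+1\<^esup>) / (1 - q\<^bsup>2r+1\<^esup>) \<Sum>\<^bsub>|j| \<le> r\<^esub> q\<^bsup>-j\<^sup>2\<^esup>\<close>: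
  nothing on the right is negative, and the summand \<open>r = 0\<close> is \<open>1 + 2q + 2q\<^sup>2 + \<dots>\<close>.

  The expansion is Bailey's lemma in base \<open>q\<^sup>2\<close> with \<open>a = q\<^sup>2\<close> and both parameters equal to \<open>q\<close>, applied to the Bailey
  pair whose \<open>\<beta>\<^sub>n\<close> is \<open>(-q; q\<^sup>2)\<^sub>n\<^sup>2 / (q\<^sup>2; q\<^sup>2)\<^bsub>2n\<^esub>\<close>. The pair comes from the finite triple product, the kernel of the
  lemma from a \<open>q\<close>-Gauss sum, and the sum over \<open>\<beta>\<^sub>n\<close> from the \<open>q\<close>-binomial theorem. For real \<open>0 < q < 1\<close> every term
  involved is nonnegative, so sums may be interchanged freely.
\<close>

section \<open>The \<open>q\<close>-Pochhammer symbol\<close>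

definition qpoch :: "'a \<Rightarrow> 'a \<Rightarrow> nat \<Rightarrow> 'a::comm_ring_1" where
  "qpoch a q n = (\<Prod>i<n. 1 - a * q ^ i)"

lemma qpoch_0 [simp]: "qpoch a q 0 = 1"
  by (simp add: qpoch_def)

lemma qpoch_Suc: "qpoch a q (Suc n) = qpoch a q n * (1 - a * q ^ n)"
  by (simp add: qpoch_def)

lemma qpoch_add: "qpoch a q (m + n) = qpoch a q m * qpoch (a * q ^ m) q n"
  by (induction n) (simp_all add: qpoch_Suc power_add mult.assoc)

lemma one_minus_qpower_pos:
  fixes a q :: real
  assumes "0 \<le> q" "q < 1" "a < 1"
  shows "1 - a * q ^ i > 0"
proof (cases "a \<le> 0")
  case True
  then show ?thesis
    using assms by (smt (verit) mult_nonpos_nonneg zero_le_power)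
next
  case False
  have "a * q ^ i \<le> a * 1"
    using assms False by (intro mult_left_mono power_le_one) auto
  then show ?thesis
    using assms by simp
qed

lemma qpoch_pos:
  fixes a q :: real
  assumes "0 \<le> q" "q < 1" "a < 1"
  shows "qpoch a q n > 0"
  unfolding qpoch_def using one_minus_qpower_pos[OF assms] by (intro prod_pos) auto

lemma qpoch_antimono:
  fixes a q :: real
  assumes "0 \<le> q" "q < 1" "0 \<le> a" "a < 1" "m \<le> n"
  shows "qpoch a q n \<le> qpoch a q m"
proof -
  have "decseq (qpoch a q)"
  proof (rule decseq_SucI)
    fix n
    have "qpoch a q n * (1 - a * q ^ n) \<le> qpoch a q n * 1"
      using assms qpoch_pos[of q a n] by (intro mult_left_mono) auto
    then show "qpoch a q (Suc n) \<le> qpoch a q n"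
      by (simp add: qpoch_Suc)
  qed
  then show ?thesis
    using \<open>m \<le> n\<close> by (simp add: decseq_def)
qed

text \<open>The terms \<open>a * q ^ i\<close> form a geometric series, so the product converges
  absolutely, and its limit is nonzero because no factor vanishes. The bound by \<open>L\<close>
  serves later in estimates that are uniform in the length of the product.\<close>

lemma qpoch_tendsto_pos:
  fixes a q :: real
  assumes "0 \<le> q" "q < 1" "0 \<le> a" "a < 1"
  obtains L where "L > 0" "qpoch a q \<longlonglongrightarrow> L" "\<And>n. L \<le> qpoch a q n"
proof -
  have "summable (\<lambda>i. norm ((1 - a * q ^ i) - 1))"
    using assms by (simp add: abs_mult power_abs)
  then have "abs_convergent_prod (\<lambda>i. 1 - a * q ^ i)"
    by (simp add: abs_convergent_prod_conv_summable)
  then have c: "convergent_prod (\<lambda>i. 1 - a * q ^ i)"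
    by (rule abs_convergent_prod_imp_convergent_prod)
  let ?L = "prodinf (\<lambda>i. 1 - a * q ^ i)"
  have "(\<lambda>n. \<Prod>i\<le>n. 1 - a * q ^ i) \<longlonglongrightarrow> ?L"
    using c by (rule convergent_prod_LIMSEQ)
  then have "(\<lambda>n. qpoch a q (Suc n)) \<longlonglongrightarrow> ?L"
    by (simp add: qpoch_def lessThan_Suc_atMost)
  then have lim: "qpoch a q \<longlonglongrightarrow> ?L"
    by (rule LIMSEQ_imp_Suc)
  have "1 - a * q ^ i \<noteq> 0" for i
    using one_minus_qpower_pos[of q a i] assms by auto
  then have "?L \<noteq> 0"
    using c by (simp add: prodinf_nonzero)
  moreover have le: "?L \<le> qpoch a q n" for n
    by (rule decseq_ge[OF _ lim]) (use qpoch_antimono[OF assms] in \<open>auto simp: decseq_def\<close>)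
  moreover have "?L \<ge> 0"
    by (rule LIMSEQ_le_const[OF lim]) (use qpoch_pos[of q a] assms in \<open>auto intro: less_imp_le\<close>)
  ultimately show ?thesis
    using that[of ?L] lim by simp
qed

lemma power2_unit:
  fixes q :: real
  assumes "0 < q" "q < 1"
  shows "0 \<le> q\<^sup>2" "q\<^sup>2 < 1"
  using assms by (auto simp: power_less_one_iff)

text \<open>Euler's series for 1/(q; q)_inf: its partial sum up to n is exactly 1/(q; q)_n, by
  telescoping.\<close>

lemma sums_power_over_qpoch:
  fixes q :: real
  assumes "0 \<le> q" "q < 1" "L > 0" "qpoch q q \<longlonglongrightarrow> L"
  shows "(\<lambda>k. q ^ k / qpoch q q k) sums (1 / L)"
proof -
  have *: "(\<Sum>k\<le>n. q ^ k / qpoch q q k) = 1 / qpoch q q n" for n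
  proof (induction n)
    case (Suc n)
    have "qpoch q q n > 0" "1 - q * q ^ n > 0"
      using assms qpoch_pos[of q q] one_minus_qpower_pos[of q q] by auto
    then show ?case
      using Suc by (simp add: qpoch_Suc field_simps)
  qed simp
  have "(\<lambda>n. 1 / qpoch q q n) \<longlonglongrightarrow> 1 / L"
    using assms by (intro tendsto_intros) auto
  then show ?thesis
    by (simp add: sums_def_le *)
qed

text \<open>Induction on n by the q-Pascal rule. As \<open>triangle k\<close> is k(k+1)/2, the
  factors on the right are 1 + z q^(i+1), whence the argument \<open>- z * q\<close>. Both sides are
  divided by (q; q)_n, which turns q-binomial coefficients into reciprocals of two products.\<close>

lemma q_binomial:
  fixes q z :: real
  assumes "0 \<le> q" "q < 1"
  shows "(\<Sum>k\<le>n. q ^ triangle k * z ^ k / (qpoch q q k * qpoch q q (n - k)))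
       = qpoch (- z * q) q n / qpoch q q n"
proof (induction n)
  case (Suc n)
  let ?p = "qpoch q q"
  have pos: "?p k > 0" "1 - q * q ^ k > 0" for k
    using assms qpoch_pos[of q q] one_minus_qpower_pos[of q q] by auto
  define f where "f n k = q ^ triangle k * z ^ k / (?p k * ?p (n - k))" for n k
  define g where "g k = (case k of 0 \<Rightarrow> 0 | Suc j \<Rightarrow> z * q * q ^ n * f n j)" for k
  \<comment> \<open>The q-Pascal rule, with \<open>g\<close> as the shifted summand. The
    \<open>if\<close> removes k = n + 1, where truncated subtraction gives \<open>f n k\<close> a
    spurious value.\<close>
  have step: "(1 - q * q ^ n) * f (Suc n) k = (if k \<le> n then f n k else 0) + g k"
    if "k \<le> Suc n" for k
  proof (cases k)
    case 0
    then show ?thesis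
      using pos[of n] by (simp add: f_def g_def qpoch_Suc)
  next
    case (Suc j)
    show ?thesis
    proof (cases "j = n")
      case True
      then show ?thesis
        using Suc pos[of n] by (simp add: f_def g_def qpoch_Suc power_add field_simps)
    next
      case False
      define d where "d = n - Suc j"
      have n: "n = Suc (j + d)"
        using False Suc that by (simp add: d_def)
      show ?thesis
        using pos[of j] pos[of d] unfolding n Suc f_def g_def
        by (simp add: Suc_diff_le qpoch_Suc power_add divide_simps) (simp add: algebra_simps)
    qed
  qed
  have "(1 - q * q ^ n) * (\<Sum>k\<le>Suc n. f (Suc n) k)
      = (\<Sum>k\<le>Suc n. (if k \<le> n then f n k else 0) + g k)"
    unfolding sum_distrib_left by (rule sum.cong) (use step in auto)
  also have "\<dots> = (\<Sum>k\<le>n. f n k) + (\<Sum>k\<le>Suc n. g k)"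
    by (simp add: sum.distrib)
  also have "(\<Sum>k\<le>Suc n. g k) = z * q * q ^ n * (\<Sum>k\<le>n. f n k)"
    by (simp only: sum.atMost_Suc_shift) (simp add: g_def sum_distrib_left)
  finally have "(1 - q * q ^ n) * (\<Sum>k\<le>Suc n. f (Suc n) k)
      = (1 + z * q * q ^ n) * (qpoch (- z * q) q n / ?p n)"
    using Suc.IH unfolding f_def by (simp only: distrib_right mult_1)
  then have "(\<Sum>k\<le>Suc n. f (Suc n) k)
      = (1 + z * q * q ^ n) * (qpoch (- z * q) q n / ?p n) / (1 - q * q ^ n)"
    using pos(2)[of n] by (metis less_irrefl nonzero_mult_div_cancel_left)
  also have "\<dots> = qpoch (- z * q) q (Suc n) / ?p (Suc n)"
    by (simp add: qpoch_Suc mult.commute)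
  finally show ?case
    unfolding f_def .
qed simp

section \<open>A Bailey pair\<close>

text \<open>The multiplicity of \<open>j\<close> when an even function is summed over all integers.\<close>
definition eps :: "nat \<Rightarrow> nat" where
  "eps j = (if j = 0 then 1 else 2)"

lemma eps_pos [simp]: "eps j > 0"
  by (simp add: eps_def)

text \<open>Rewrites a q-binomial sum that is symmetric about its middle index in terms of the
  distance from the middle, where distance 0 is met once and every other distance twice.\<close>

lemma sum_centered:
  fixes f g :: "nat \<Rightarrow> real"
  assumes "\<And>j. j \<le> n \<Longrightarrow> f (n + j) = g j" "\<And>j. j \<le> n \<Longrightarrow> f (n - j) = g j"
  shows "(\<Sum>k\<le>2 * n. f k) = (\<Sum>j\<le>n. eps j * g j)"
proof -
  have lower: "g (n - k) = f k" if "k < n" for k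
    using assms(2)[of "n - k"] that by simp
  have upper: "f k = g (k - n)" if "n \<le> k" "k \<le> 2 * n" for k
    using assms(1)[of "k - n"] that by simp
  have "{..2 * n} = {..<n} \<union> {n..2 * n}"
    by auto
  then have "(\<Sum>k\<le>2 * n. f k) = (\<Sum>k<n. f k) + (\<Sum>k=n..2 * n. f k)"
    by (simp add: sum.union_disjoint ivl_disj_int)
  also have "(\<Sum>k<n. f k) = (\<Sum>j=1..n. g j)"
    by (rule sum.reindex_bij_witness[of _ "\<lambda>j. n - j" "\<lambda>j. n - j"]) (use lower in auto)
  also have "(\<Sum>k=n..2 * n. f k) = (\<Sum>j\<le>n. g j)"
    by (rule sum.reindex_bij_witness[of _ "\<lambda>j. n + j" "\<lambda>j. j - n"]) (use upper in auto)
  also have "(\<Sum>j=1..n. g j) + (\<Sum>j\<le>n. g j) = (\<Sum>j\<le>n. eps j * g j)"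
  proof -
    have "{..n} = insert 0 {1..n}"
      by auto
    moreover have "(\<Sum>j=1..n. eps j * g j) = (\<Sum>j=1..n. g j + g j)"
      by (rule sum.cong) (auto simp: eps_def)
    ultimately show ?thesis
      by (simp add: eps_def sum.distrib sum_distrib_left)
  qed
  finally show ?thesis .
qed

lemma prod_odd_powers:
  fixes q :: "'a::comm_monoid_mult"
  shows "(\<Prod>i<n. q ^ (2 * i + 1)) = q ^ (n ^ 2)"
proof (induction n)
  case (Suc n)
  have "(Suc n)\<^sup>2 = n\<^sup>2 + (2 * n + 1)"
    by (simp add: power2_eq_square)
  then show ?case
    using Suc by (simp only: prod.lessThan_Suc power_add)
qed simp

text \<open>The factors of the left-hand product with index below \<open>n\<close> contain negative powers of \<open>q\<close>; they are
  reflected onto the others at the cost of \<open>q\<^bsup>n\<^sup>2\<^esup>\<close>.\<close>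
lemma qpoch_centered:
  fixes q :: real
  assumes "0 < q" "q < 1"
  shows "qpoch (- (q / q ^ (2 * n))) (q\<^sup>2) (2 * n) * q ^ (n\<^sup>2) = (qpoch (- q) (q\<^sup>2) n)\<^sup>2"
proof -
  have "qpoch (- (q / q ^ (2 * n))) (q\<^sup>2) (2 * n)
      = qpoch (- (q / q ^ (2 * n))) (q\<^sup>2) n * qpoch (- (q / q ^ (2 * n)) * (q\<^sup>2) ^ n) (q\<^sup>2) n"
    unfolding mult_2[of n] by (rule qpoch_add)
  also have "- (q / q ^ (2 * n)) * (q\<^sup>2) ^ n = - q"
    using assms by (simp flip: power_mult)
  also have "qpoch (- (q / q ^ (2 * n))) (q\<^sup>2) n = (\<Prod>i<n. 1 + q ^ (2 * i + 1) / q ^ (2 * n))"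
    by (simp add: qpoch_def flip: power_mult)
  also have "\<dots> = (\<Prod>i<n. 1 + 1 / q ^ (2 * i + 1))"
  proof (rule prod.reindex_bij_witness[of _ "\<lambda>i. n - Suc i" "\<lambda>i. n - Suc i"])
    fix i assume "i \<in> {..<n}"
    then obtain d where "n = Suc (i + d)"
      by (auto simp: less_iff_Suc_add)
    then have "q ^ (2 * n) = q ^ (2 * i + 1) * q ^ (2 * (n - Suc i) + 1)"
      by (simp flip: power_add)
    then show "1 + 1 / q ^ (2 * (n - Suc i) + 1) = 1 + q ^ (2 * i + 1) / q ^ (2 * n)"
      using assms by simp
  qed auto
  finally have "qpoch (- (q / q ^ (2 * n))) (q\<^sup>2) (2 * n) * q ^ (n\<^sup>2)
      = (\<Prod>i<n. (1 + 1 / q ^ (2 * i + 1)) * q ^ (2 * i + 1)) * qpoch (- q) (q\<^sup>2) n"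
    by (simp add: prod.distrib flip: prod_odd_powers)
  also have "(\<Prod>i<n. (1 + 1 / q ^ (2 * i + 1)) * q ^ (2 * i + 1)) = qpoch (- q) (q\<^sup>2) n"
    unfolding qpoch_def
  proof (rule prod.cong)
    fix i
    have "(q\<^sup>2) ^ i = q ^ (2 * i)"
      by (simp add: power_mult)
    then show "(1 + 1 / q ^ (2 * i + 1)) * q ^ (2 * i + 1) = 1 - - q * (q\<^sup>2) ^ i"
      using assms by (simp add: field_simps)
  qed simp
  finally show ?thesis
    by (simp add: power2_eq_square)
qed

lemma triangle_double: "2 * triangle n = n * Suc n"
  by (simp add: triangle_def)

text \<open>This is the q-binomial theorem in base q^2 with 2n factors and z = q^(-2n-1), the choice
  that centres the exponents at k = n. The result is a finite form of Jacobi's triple product at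
  argument 1.\<close>

lemma finite_triple_product:
  fixes q :: real
  assumes "0 < q" "q < 1"
  shows "(\<Sum>j\<le>n. eps j * (q ^ j\<^sup>2 / (qpoch (q\<^sup>2) (q\<^sup>2) (n - j) * qpoch (q\<^sup>2) (q\<^sup>2) (n + j))))
       = (qpoch (- q) (q\<^sup>2) n)\<^sup>2 / qpoch (q\<^sup>2) (q\<^sup>2) (2 * n)"
proof -
  let ?E = "qpoch (q\<^sup>2) (q\<^sup>2)"
  let ?z = "1 / q ^ (2 * n + 1)"
  note q2 = power2_unit[OF assms(1,2)]
  \<comment> \<open>Completing the square: 2 \<open>triangle k\<close> - (2n+1)k + n^2 = (k-n)^2.
    The disjunction expresses |k - n| = j without subtraction.\<close>
  have pw: "(q\<^sup>2) ^ triangle k * ?z ^ k * q ^ (n\<^sup>2) = q ^ j\<^sup>2" if "k = n + j \<or> n = k + j" for k j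
  proof -
    have e: "2 * triangle k + n\<^sup>2 = j\<^sup>2 + (2 * n + 1) * k"
      using that triangle_double[of k] by (auto simp: power2_eq_square algebra_simps)
    have "(q\<^sup>2) ^ triangle k * q ^ (n\<^sup>2) = q ^ j\<^sup>2 * (q ^ (2 * n + 1)) ^ k"
      by (simp only: e flip: power_mult power_add)
    then show ?thesis
      using assms by (simp add: field_simps power_divide)
  qed
  have "(\<Sum>k\<le>2 * n. (q\<^sup>2) ^ triangle k * ?z ^ k / (?E k * ?E (2 * n - k)) * q ^ (n\<^sup>2))
      = (\<Sum>j\<le>n. eps j * (q ^ j\<^sup>2 / (?E (n - j) * ?E (n + j))))"
  proof (rule sum_centered)
    fix j assume j: "j \<le> n"
    have "2 * n - (n + j) = n - j" "2 * n - (n - j) = n + j"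
      using j by auto
    then show "(q\<^sup>2) ^ triangle (n + j) * ?z ^ (n + j) / (?E (n + j) * ?E (2 * n - (n + j))) * q ^ (n\<^sup>2)
          = q ^ j\<^sup>2 / (?E (n - j) * ?E (n + j))"
      "(q\<^sup>2) ^ triangle (n - j) * ?z ^ (n - j) / (?E (n - j) * ?E (2 * n - (n - j))) * q ^ (n\<^sup>2)
          = q ^ j\<^sup>2 / (?E (n - j) * ?E (n + j))"
      using pw[of "n + j" j] pw[of "n - j" j] j by (simp_all add: mult.commute)
  qed
  then have "(\<Sum>j\<le>n. eps j * (q ^ j\<^sup>2 / (?E (n - j) * ?E (n + j))))
      = qpoch (- ?z * q\<^sup>2) (q\<^sup>2) (2 * n) / ?E (2 * n) * q ^ (n\<^sup>2)"
    unfolding sum_distrib_right[symmetric] q_binomial[OF q2] by (rule sym)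
  also have "- ?z * q\<^sup>2 = - (q / q ^ (2 * n))"
    using assms by (simp add: power2_eq_square)
  finally show ?thesis
    using qpoch_centered[OF assms, of n] by (simp add: mult.commute)
qed

text \<open>For r < n the summand is the difference of the right-hand side at r and at r + 1, and
  for r = n it is the right-hand side itself; hence the induction runs downward from j = n.\<close>

lemma sum_telescope_kernel:
  fixes q :: real
  assumes "0 < q" "q < 1" "j \<le> n"
  shows "(\<Sum>r=j..n. q ^ (2 * r\<^sup>2) * (1 - q ^ (4 * r + 2))
             / (qpoch (q\<^sup>2) (q\<^sup>2) (n - r) * qpoch (q\<^sup>2) (q\<^sup>2) (Suc (n + r))))
       = q ^ (2 * j\<^sup>2) / (qpoch (q\<^sup>2) (q\<^sup>2) (n - j) * qpoch (q\<^sup>2) (q\<^sup>2) (n + j))"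
  using \<open>j \<le> n\<close>
proof (induction j rule: inc_induct)
  let ?E = "qpoch (q\<^sup>2) (q\<^sup>2)"
  note q2 = power2_unit[OF assms(1,2)]
  have pos: "?E k > 0" "1 - q\<^sup>2 * (q\<^sup>2) ^ k > 0" for k
    using q2 qpoch_pos[of "q\<^sup>2" "q\<^sup>2"] one_minus_qpower_pos[of "q\<^sup>2" "q\<^sup>2"] by auto
  {
    case base
    have "q ^ (4 * n + 2) = q\<^sup>2 * (q\<^sup>2) ^ (n + n)"
      by (simp flip: power_mult power_add)
    then show ?case
      using pos[of "n + n"] by (simp add: qpoch_Suc)
  next
    case (step j)
    define d where "d = n - Suc j"
    have n: "n = Suc (j + d)"
      using step by (simp add: d_def)
    \<comment> \<open>All powers in the step are monomials in q, X and Y, apart from the common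
      factor q^(2j^2), so the claim becomes a rational identity.\<close>
    define X Y where "X = q ^ (2 * j)" and "Y = q ^ (2 * d)"
    have e: "q ^ (4 * j + 2) = q\<^sup>2 * X\<^sup>2" "(q\<^sup>2) ^ d = Y" "q ^ (2 * (Suc j)\<^sup>2) = q ^ (2 * j\<^sup>2) * X\<^sup>2 * q\<^sup>2"
      "(q\<^sup>2) ^ (n + j) = q\<^sup>2 * X\<^sup>2 * Y"
    proof -
      have "2 * (Suc j)\<^sup>2 = 2 * j\<^sup>2 + 2 * j * 2 + 2"
        by (simp add: power2_eq_square)
      then show "q ^ (2 * (Suc j)\<^sup>2) = q ^ (2 * j\<^sup>2) * X\<^sup>2 * q\<^sup>2"
        by (simp add: X_def flip: power_mult power_add)
      have "4 * j + 2 = 2 + 2 * j * 2" "2 * (n + j) = 2 + 2 * j * 2 + 2 * d"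
        by (simp_all add: n)
      then show "q ^ (4 * j + 2) = q\<^sup>2 * X\<^sup>2" "(q\<^sup>2) ^ (n + j) = q\<^sup>2 * X\<^sup>2 * Y"
        by (simp_all only: X_def Y_def power_mult[symmetric] power_add[symmetric])
    qed (simp add: Y_def flip: power_mult)
    have p: "?E d > 0" "?E (n + j) > 0" "1 - q\<^sup>2 * Y > 0" "1 - q\<^sup>2 * (q\<^sup>2 * X\<^sup>2 * Y) > 0"
      using pos[of d] pos[of "n + j"] unfolding e by auto
    have 1: "(\<Sum>r=j..n. q ^ (2 * r\<^sup>2) * (1 - q ^ (4 * r + 2)) / (?E (n - r) * ?E (Suc (n + r))))
        = q ^ (2 * j\<^sup>2) * (1 - q ^ (4 * j + 2)) / (?E (n - j) * ?E (Suc (n + j)))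
          + q ^ (2 * (Suc j)\<^sup>2) / (?E (n - Suc j) * ?E (n + Suc j))"
      using step by (simp add: sum.atLeast_Suc_atMost)
    have 2: "?E (n - j) = ?E d * (1 - q\<^sup>2 * Y)" "?E (Suc (n + j)) = ?E (n + j) * (1 - q\<^sup>2 * (q\<^sup>2 * X\<^sup>2 * Y))"
       "?E (n + Suc j) = ?E (n + j) * (1 - q\<^sup>2 * (q\<^sup>2 * X\<^sup>2 * Y))" "n - Suc j = d"
      using e(2) by (simp_all only: qpoch_Suc e add_Suc_right) (simp_all add: n qpoch_Suc e(2))
    show ?case
      unfolding 1 2 unfolding e using p
      by (simp add: divide_simps) (simp add: algebra_simps)
  }
qed

section \<open>Gauss's product for the series of triangular exponents\<close>

text \<open>The partial products of Gauss's product (x^2; x^2)_inf / (x; x^2)_inf.\<close>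

definition gauss_quot :: "real \<Rightarrow> nat \<Rightarrow> real" where
  "gauss_quot x n = qpoch (x\<^sup>2) (x\<^sup>2) n / qpoch x (x\<^sup>2) n"

lemma gauss_quot_0 [simp]: "gauss_quot x 0 = 1"
  by (simp add: gauss_quot_def)

lemma gauss_quot_Suc:
  "gauss_quot x (Suc n) = gauss_quot x n * ((1 - x ^ (2 * n + 2)) / (1 - x ^ (2 * n + 1)))"
proof -
  have "x * (x\<^sup>2) ^ n = x ^ (2 * n + 1)" "x\<^sup>2 * (x\<^sup>2) ^ n = x ^ (2 * n + 2)"
    by (simp_all add: power_mult power_add power2_eq_square)
  then show ?thesis
    by (simp only: gauss_quot_def qpoch_Suc times_divide_times_eq)
qed

text \<open>Shanks's finite form of Gauss's product: as \<open>n\<close> grows, only the summand \<open>s = 0\<close> on the right survives.\<close>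
lemma shanks:
  fixes x :: real
  assumes "0 < x" "x < 1"
  shows "(\<Sum>s<2 * n. x ^ triangle s) = (\<Sum>s<n. gauss_quot x n / gauss_quot x s * x ^ (s * (2 * n + 1)))"
proof (induction n)
  case (Suc n)
  have lt: "x ^ Suc k < 1" for k
    using assms power_Suc_less_one[of x] by simp
  have p: "gauss_quot x k > 0" for k
    using lt[of "2 * _"] lt[of "2 * _ + 1"] 
    by (induction k) (simp_all add: gauss_quot_Suc)
  define A where "A n s = gauss_quot x n / gauss_quot x s * x ^ (s * (2 * n + 1))" for n s
  \<comment> \<open>\<open>B\<close> is the telescoping certificate: increasing n changes
    \<open>A n s\<close> by \<open>B (Suc s) - B s\<close>, and \<open>B 0 = 0\<close>.\<close>
  define B where "B s = A n s * (1 - x ^ (2 * s)) / (1 - x ^ (2 * n + 1))" for s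
  have c: "1 - x ^ (2 * k + 1) > 0" "1 - x ^ (2 * k + 2) > 0" for k
    using lt[of "2 * k"] lt[of "2 * k + 1"] by simp_all
  have step: "A (Suc n) s = A n s + (B (Suc s) - B s)" for s
  proof -
    have e: "x ^ (s * (2 * Suc n + 1)) = x ^ (s * (2 * n + 1)) * x ^ (2 * s)"
       "x ^ (Suc s * (2 * n + 1)) = x ^ (s * (2 * n + 1)) * x ^ (2 * n + 1)"
       "x ^ (2 * Suc s) = x ^ (2 * s + 2)"
      by (simp_all add: algebra_simps flip: power_add)
    show ?thesis
      using p[of s] p[of n] c[of n] c[of s] unfolding A_def B_def e
      by (simp add: gauss_quot_Suc divide_simps) (simp add: algebra_simps)
  qed
  have "(\<Sum>s<Suc n. A (Suc n) s) = (\<Sum>s<n. A n s) + (B n - B 0 + A (Suc n) n)"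
    by (simp add: step sum.distrib sum_lessThan_telescope)
  also have "(\<Sum>s<n. A n s) = (\<Sum>s<2 * n. x ^ triangle s)"
    using Suc.IH by (simp add: A_def)
  \<comment> \<open>The boundary terms are precisely the two summands that the left-hand side
    gains.\<close>
  also have "B n - B 0 + A (Suc n) n = x ^ triangle (2 * n) + x ^ triangle (Suc (2 * n))"
  proof -
    have t: "triangle (2 * n) = n * (2 * n + 1)" "triangle (Suc (2 * n)) = n * (2 * n + 1) + (2 * n + 1)"
      by (simp_all add: triangle_def)
    have e: "x ^ (n * (2 * Suc n + 1)) = x ^ (n * (2 * n + 1)) * x ^ (2 * n)"
      by (simp add: algebra_simps flip: power_add)
    show ?thesis
      using p[of n] c[of n] unfolding t power_add[of x _ "2 * n + 1"]
      unfolding A_def B_def e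
      by (simp add: gauss_quot_Suc divide_simps) (simp add: algebra_simps)
  qed
  finally show ?case
    by (simp add: A_def)
qed simp

section \<open>Gauss's theta series: its product and its expansion over
  \<open>gauss_quot\<close>\<close>

definition psi :: "real \<Rightarrow> real" where
  "psi x = (\<Sum>k. x ^ triangle k)"

lemma triangle_ge: "n \<le> triangle n"
  by (induction n) auto

context
  fixes x :: real
  assumes x: "0 < x" "x < 1"
begin

lemma power_pos_less_one: "n > 0 \<Longrightarrow> x ^ n < 1"
  using x by (simp add: power_less_one_iff)

lemma psi_sums: "(\<lambda>k. x ^ triangle k) sums psi x"
proof -
  have "summable (\<lambda>k. x ^ triangle k)"
  proof (rule summable_comparison_test')
    show "summable (\<lambda>k. x ^ k)"
      using x by (intro summable_geometric) auto
    show "norm (x ^ triangle k) \<le> x ^ k" if "k \<ge> 0" for k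
      using x triangle_ge[of k] by (simp add: power_decreasing)
  qed
  then show ?thesis
    by (simp add: psi_def summable_sums)
qed

lemma gauss_quot_ge_1: "gauss_quot x n \<ge> 1"
proof (induction n)
  case (Suc n)
  have "x ^ (2 * n + 2) \<le> x ^ (2 * n + 1)"
    using x by (intro power_decreasing) auto
  moreover have "x ^ (2 * n + 1) < 1"
    by (rule power_pos_less_one) simp
  ultimately have "(1 - x ^ (2 * n + 2)) / (1 - x ^ (2 * n + 1)) \<ge> 1"
    by simp
  then have "gauss_quot x n * ((1 - x ^ (2 * n + 2)) / (1 - x ^ (2 * n + 1))) \<ge> 1 * 1"
    using Suc by (intro mult_mono) auto
  then show ?case
    by (simp add: gauss_quot_Suc)
qed simp

lemma gauss_quot_pos: "gauss_quot x n > 0"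
  using gauss_quot_ge_1[of n] by linarith

text \<open>Gauss's identity. In \<open>shanks\<close> the summand s = 0 is
  \<open>gauss_quot x n\<close>; the fewer than n others are at most M x^n each, so together they
  are bounded by M n x^n, which tends to 0.\<close>

lemma gauss_quot_tendsto_psi: "gauss_quot x \<longlonglongrightarrow> psi x"
proof -
  obtain LE where LE: "LE > 0" "qpoch (x\<^sup>2) (x\<^sup>2) \<longlonglongrightarrow> LE"
    using qpoch_tendsto_pos[of "x\<^sup>2" "x\<^sup>2"] power2_unit[OF x] by auto
  obtain LO where LO: "LO > 0" "qpoch x (x\<^sup>2) \<longlonglongrightarrow> LO"
    using qpoch_tendsto_pos[of "x\<^sup>2" x] power2_unit[OF x] x by auto
  have "gauss_quot x \<longlonglongrightarrow> LE / LO"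
    unfolding gauss_quot_def using LE LO by (intro tendsto_divide) auto
  \<comment> \<open>Convergence supplies the uniform bound M; the value of the limit comes from the
    comparison below.\<close>
  then have "convergent (gauss_quot x)"
    by (auto simp: convergent_def)
  then obtain M where M: "\<And>n. gauss_quot x n \<le> M"
    using Bseq_def[of "gauss_quot x"] convergent_imp_Bseq[of "gauss_quot x"] abs_le_D1
    unfolding real_norm_def by blast
  let ?A = "\<lambda>n s. gauss_quot x n / gauss_quot x s * x ^ (s * (2 * n + 1))"
  have dist: "\<bar>(\<Sum>s<2 * n. x ^ triangle s) - gauss_quot x n\<bar> \<le> M * (real n * x ^ n)" if "n > 0" for n
  proof -
    have "(\<Sum>s<n. ?A n s) = ?A n 0 + (\<Sum>s\<in>{..<n} - {0}. ?A n s)"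
      using that by (intro sum.remove) auto
    then have "(\<Sum>s<2 * n. x ^ triangle s) - gauss_quot x n = (\<Sum>s\<in>{..<n} - {0}. ?A n s)"
      by (simp add: shanks[OF x])
    moreover have "0 \<le> ?A n s" for s
      using gauss_quot_pos[of n] gauss_quot_pos[of s] x by simp
    then have "0 \<le> (\<Sum>s\<in>{..<n} - {0}. ?A n s)"
      by (intro sum_nonneg) auto
    moreover have "(\<Sum>s\<in>{..<n} - {0}. ?A n s) \<le> (\<Sum>s\<in>{..<n} - {0}. M * x ^ n)"
    proof (rule sum_mono)
      fix s assume "s \<in> {..<n} - {0}"
      then have "n \<le> s * (2 * n + 1)"
        by (cases s) auto
      then have "x ^ (s * (2 * n + 1)) \<le> x ^ n"
        using x by (intro power_decreasing) auto
      moreover have "gauss_quot x n / gauss_quot x s \<le> M / 1"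
        using M[of n] gauss_quot_ge_1[of s] gauss_quot_pos[of n] by (intro frac_le) auto
      ultimately show "?A n s \<le> M * x ^ n"
        using x gauss_quot_pos[of n] gauss_quot_pos[of s] M[of n] by (intro mult_mono) auto
    qed
    moreover have "(\<Sum>s\<in>{..<n} - {0}. M * x ^ n) \<le> real n * (M * x ^ n)"
      using x M[of 0] by (simp add: card_Diff_singleton_if mult_right_mono)
    ultimately show ?thesis
      by (simp add: algebra_simps)
  qed
  have "(\<lambda>n. M * (real n * x ^ n)) \<longlonglongrightarrow> M * 0"
    using x by (intro tendsto_mult tendsto_const powser_times_n_limit_0) auto
  then have "(\<lambda>n. (\<Sum>s<2 * n. x ^ triangle s) - gauss_quot x n) \<longlonglongrightarrow> 0"
    unfolding mult_zero_right
  proof (rule Lim_null_comparison[rotated])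
    show "\<forall>\<^sub>F n in sequentially. norm ((\<Sum>s<2 * n. x ^ triangle s) - gauss_quot x n) \<le> M * (real n * x ^ n)"
      unfolding real_norm_def by (rule eventually_mono[OF eventually_gt_at_top[of 0] dist])
  qed
  moreover have "(\<lambda>n. \<Sum>s<2 * n. x ^ triangle s) \<longlonglongrightarrow> psi x"
    using LIMSEQ_subseq_LIMSEQ[OF psi_sums[unfolded sums_def], of "\<lambda>n. 2 * n"]
    by (simp add: strict_mono_def o_def)
  ultimately show ?thesis
    using tendsto_diff[of "\<lambda>n. \<Sum>s<2 * n. x ^ triangle s" "psi x" sequentially
        "\<lambda>n. (\<Sum>s<2 * n. x ^ triangle s) - gauss_quot x n" 0] by simp
qed

lemma psi_pos: "psi x > 0"
  using LIMSEQ_le_const[OF gauss_quot_tendsto_psi, of 1] gauss_quot_ge_1 by force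

text \<open>The function \<open>F(z) = \<Sum>\<^sub>n z\<^sup>n / gauss_quot x n\<close> satisfies \<open>(1 - z) F(z) = (1 - x z) F(x\<^sup>2 z)\<close>, which is
  iterated along \<open>z = x\<^bsup>2k+1\<^esup>\<close>.\<close>
lemma sums_power_over_gauss_quot: "(\<lambda>n. x ^ n / gauss_quot x n) sums psi x"
proof -
  let ?b = "\<lambda>n. 1 / gauss_quot x n"
  \<comment> \<open>\<open>F k\<close> is the function F at the point z = x^(2k+1), so that z
    \<rightarrow> x^2 z is the step from k to k + 1.\<close>
  define F where "F k = (\<Sum>n. ?b n * (x ^ (2 * k + 1)) ^ n)" for k
  have b: "0 < ?b n" "?b n \<le> 1" for n
    using gauss_quot_pos[of n] gauss_quot_ge_1[of n] by auto
  have z: "0 < x ^ (2 * k + 1)" "x ^ (2 * k + 1) < 1" for k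
    using x power_pos_less_one[of "2 * k + 1"] by auto
  have geo: "(\<lambda>n. (x ^ (2 * k + 1)) ^ n) sums (1 / (1 - x ^ (2 * k + 1)))" for k
    using z[of k] by (intro geometric_sums) simp
  have le: "?b n * (x ^ (2 * k + 1)) ^ n \<le> (x ^ (2 * k + 1)) ^ n" for n k
    using b[of n] z[of k] by (intro mult_left_le_one_le) auto
  have F_sums: "(\<lambda>n. ?b n * (x ^ (2 * k + 1)) ^ n) sums F k" for k
  proof -
    have "summable (\<lambda>n. ?b n * (x ^ (2 * k + 1)) ^ n)"
    proof (rule summable_comparison_test'[OF sums_summable[OF geo[of k]], of 0])
      show "norm (?b n * (x ^ (2 * k + 1)) ^ n) \<le> (x ^ (2 * k + 1)) ^ n" for n
        using le[of n k] b(1)[of n] z(1)[of k] by (subst real_norm_def, subst abs_of_pos) simp_all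
    qed
    then show ?thesis
      by (simp add: F_def summable_sums)
  qed
  have rec: "F k = (1 - x ^ (2 * k + 2)) / (1 - x ^ (2 * k + 1)) * F (Suc k)" for k
  proof -
    let ?z = "x ^ (2 * k + 1)"
    have z2: "x ^ (2 * Suc k + 1) = x\<^sup>2 * ?z"
      by (simp add: power2_eq_square)
    have S: "(\<lambda>n. ?b n * ?z ^ n) sums F k" "(\<lambda>n. ?b n * (x\<^sup>2 * ?z) ^ n) sums F (Suc k)"
      using F_sums[of k] F_sums[of "Suc k"] unfolding z2 by auto
    have "(\<lambda>n. ?b n * ?z ^ n - ?b n * (x\<^sup>2 * ?z) ^ n) sums (F k - F (Suc k))"
      using S by (rule sums_diff)
    \<comment> \<open>The two constant terms cancel; in the shifted series a factor z comes out, and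
      the recurrence of the coefficients applies.\<close>
    then have "(\<lambda>n. ?b (Suc n) * ?z ^ Suc n - ?b (Suc n) * (x\<^sup>2 * ?z) ^ Suc n) sums (F k - F (Suc k))"
      by (subst sums_Suc_iff) simp
    moreover have "?b (Suc n) * ?z ^ Suc n - ?b (Suc n) * (x\<^sup>2 * ?z) ^ Suc n
        = ?z * (?b n * ?z ^ n - x * (?b n * (x\<^sup>2 * ?z) ^ n))" for n
    proof -
      have "1 - x ^ (2 * n + 1) > 0" "1 - x ^ (2 * n + 2) > 0"
        using power_pos_less_one[of "2 * n + 1"] power_pos_less_one[of "2 * n + 2"] by auto
      then have "?b (Suc n) * (1 - x ^ (2 * n + 2)) = ?b n * (1 - x ^ (2 * n + 1))"
        using gauss_quot_pos[of n] by (simp add: gauss_quot_Suc divide_simps)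
      moreover have "(x\<^sup>2) ^ n = x ^ (2 * n)"
        by (simp add: power_mult)
      then have "?b (Suc n) * ?z ^ Suc n - ?b (Suc n) * (x\<^sup>2 * ?z) ^ Suc n
          = ?z ^ Suc n * (?b (Suc n) * (1 - x ^ (2 * n + 2)))"
        "?z * (?b n * ?z ^ n - x * (?b n * (x\<^sup>2 * ?z) ^ n))
          = ?z ^ Suc n * (?b n * (1 - x ^ (2 * n + 1)))"
        by (simp_all add: power_mult_distrib power2_eq_square algebra_simps)
      ultimately show ?thesis
        by simp
    qed
    ultimately have "(\<lambda>n. ?z * (?b n * ?z ^ n - x * (?b n * (x\<^sup>2 * ?z) ^ n))) sums (F k - F (Suc k))"
      by simp
    moreover have "(\<lambda>n. ?z * (?b n * ?z ^ n - x * (?b n * (x\<^sup>2 * ?z) ^ n))) sums (?z * (F k - x * F (Suc k)))"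
      by (intro sums_mult sums_diff S)
    ultimately have "F k - F (Suc k) = ?z * (F k - x * F (Suc k))"
      by (rule sums_unique2)
    then have "(1 - ?z) * F k = (1 - x ^ (2 * k + 2)) * F (Suc k)"
      by (simp add: algebra_simps)
    then show ?thesis
      using z(2)[of k] by (simp add: field_simps)
  qed
  have F0: "F 0 = gauss_quot x k * F k" for k
  proof (induction k)
    case (Suc k)
    then show ?case
      unfolding rec[of k] gauss_quot_Suc by (simp only: mult.assoc)
  qed simp
  have "(\<lambda>k. x ^ (2 * k + 1)) \<longlonglongrightarrow> 0"
  proof -
    have "(\<lambda>k. x * (x\<^sup>2) ^ k) \<longlonglongrightarrow> x * 0"
      using power2_unit[OF x] by (intro tendsto_intros LIMSEQ_power_zero) auto
    then show ?thesis
      by (simp add: power_mult)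
  qed
  then have "(\<lambda>k. 1 / (1 - x ^ (2 * k + 1))) \<longlonglongrightarrow> 1 / (1 - 0)"
    by (intro tendsto_intros) auto
  then have upper: "(\<lambda>k. 1 / (1 - x ^ (2 * k + 1))) \<longlonglongrightarrow> 1"
    by simp
  \<comment> \<open>F lies between its constant term 1 and the geometric series, whose sum tends to
    1 as z tends to 0.\<close>
  have "F \<longlonglongrightarrow> 1"
  proof (rule tendsto_sandwich[OF _ _ tendsto_const upper])
    have "F k \<le> 1 / (1 - x ^ (2 * k + 1))" for k
      by (rule sums_le[OF _ F_sums geo]) (rule le)
    then show "\<forall>\<^sub>F k in sequentially. F k \<le> 1 / (1 - x ^ (2 * k + 1))"
      by simp
    have "1 \<le> F k" for k
      by (rule sums_le[OF _ sums_single[of 0 "\<lambda>_. 1"] F_sums]) (use b z[of k] in \<open>auto simp: less_imp_le\<close>)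
    then show "\<forall>\<^sub>F k in sequentially. 1 \<le> F k"
      by simp
  qed
  then have "(\<lambda>k. gauss_quot x k * F k) \<longlonglongrightarrow> psi x * 1"
    by (intro tendsto_mult gauss_quot_tendsto_psi)
  then have "F 0 = psi x"
    unfolding F0[symmetric] by (simp add: LIMSEQ_const_iff)
  then show ?thesis
    using F_sums[of 0] by simp
qed

end

section \<open>A \<open>q\<close>-Gauss sum\<close>

text \<open>The summand of the inner sum in Bailey's lemma for fixed r, after the substitution n = r
  + k and with q^(2r) taken out.\<close>

definition gauss_term :: "real \<Rightarrow> nat \<Rightarrow> nat \<Rightarrow> real" where
  "gauss_term q r k = (qpoch q (q\<^sup>2) (r + k))\<^sup>2 * q ^ (2 * k)
     / (qpoch (q\<^sup>2) (q\<^sup>2) k * qpoch (q\<^sup>2) (q\<^sup>2) (Suc (k + 2 * r)))"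

context
  fixes q :: real
  assumes q: "0 < q" "q < 1"
begin

lemma qpoch_even_pos: "qpoch (q\<^sup>2) (q\<^sup>2) n > 0"
  using qpoch_pos[of "q\<^sup>2" "q\<^sup>2"] power2_unit[OF q] by simp

lemma qpoch_odd_pos: "qpoch q (q\<^sup>2) n > 0"
  using qpoch_pos[of "q\<^sup>2" q] power2_unit[OF q] q by simp

text \<open>The right-hand side is a Wilf-Zeilberger certificate; it tends to \<open>0\<close>, so
  \<open>(1 - q\<^bsup>2r+1\<^esup>)\<^sup>2 \<Sum>\<^sub>k gauss_term q r k\<close> does not depend on \<open>r\<close>.\<close>
lemma gauss_term_telescope:
  "(\<Sum>k\<le>m. (1 - q ^ (2 * r + 1))\<^sup>2 * gauss_term q r k)
     - (\<Sum>k<m. (1 - q ^ (2 * Suc r + 1))\<^sup>2 * gauss_term q (Suc r) k)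
   = (1 - q ^ (4 * r + 4)) * q ^ (2 * m) * (qpoch q (q\<^sup>2) (Suc (r + m)))\<^sup>2
     / (qpoch (q\<^sup>2) (q\<^sup>2) m * qpoch (q\<^sup>2) (q\<^sup>2) (Suc (Suc (m + 2 * r))))"
proof (induction m)
  let ?O = "qpoch q (q\<^sup>2)" and ?E = "qpoch (q\<^sup>2) (q\<^sup>2)"
  {
    case 0
    \<comment> \<open>For m = 0 the second sum is empty, so the certificate has to equal the term k
      = 0 of the first sum.\<close>
    have "?O (Suc r) = ?O r * (1 - q ^ (2 * r + 1))"
      by (simp add: qpoch_Suc power_mult)
    moreover have "?E (Suc (Suc (2 * r))) = ?E (Suc (2 * r)) * (1 - q ^ (4 * r + 4))"
    proof -
      have "q\<^sup>2 * (q\<^sup>2) ^ Suc (2 * r) = q ^ (4 * r + 4)"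
      proof -
        have "4 * r + 4 = 2 + 2 * Suc (2 * r)"
          by simp
        then show ?thesis
          by (simp only: power_mult power_add)
      qed
      then show ?thesis
        by (simp only: qpoch_Suc[of _ _ "Suc (2 * r)"])
    qed
    moreover have "1 - q ^ (4 * r + 4) > 0"
      using power_pos_less_one[OF q, of "4 * r + 4"] by simp
    ultimately show ?case
      by (simp add: gauss_term_def power_mult_distrib)
  next
    case (Suc m)
    define X R where "X = q ^ (2 * m)" and "R = q ^ (2 * r)"
    have R: "q ^ (2 * r + 1) = q * R" "q ^ (2 * Suc r + 1) = q ^ 3 * R" "q ^ (4 * r + 4) = R\<^sup>2 * q ^ 4"
      by (simp_all add: R_def power_add power_mult eval_nat_numeral)
    have X: "q ^ (2 * Suc m) = X * q\<^sup>2"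
      by (simp add: X_def power2_eq_square)
    have e: "(q\<^sup>2) ^ m = X" "(q\<^sup>2) ^ Suc (r + m) = q\<^sup>2 * X * R"
        "(q\<^sup>2) ^ Suc (Suc (m + 2 * r)) = q ^ 4 * X * R\<^sup>2"
      by (simp_all add: X_def R_def power_add power_mult power_mult_distrib eval_nat_numeral)
    define U V W where "U = ?O (Suc (r + m))" and "V = ?E m" and "W = ?E (Suc (Suc (m + 2 * r)))"
    have O: "?O (r + Suc m) = U" "?O (Suc r + m) = U" "?O (Suc (r + Suc m)) = U * (1 - q * (q\<^sup>2 * X * R))"
      unfolding U_def by (simp_all add: qpoch_Suc[of _ _ "Suc _"] e del: power_Suc)
    have E: "?E (Suc m) = V * (1 - q\<^sup>2 * X)" "?E (Suc (Suc m + 2 * r)) = W"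
       "?E (Suc (m + 2 * Suc r)) = W * (1 - q\<^sup>2 * (q ^ 4 * X * R\<^sup>2))"
       "?E (Suc (Suc (Suc m + 2 * r))) = W * (1 - q\<^sup>2 * (q ^ 4 * X * R\<^sup>2))"
      unfolding V_def W_def by (simp_all add: qpoch_Suc[of _ _ "Suc (Suc _)"] qpoch_Suc[of _ _ m] e del: power_Suc)
    have "?E (Suc m) > 0" "?E (Suc (m + 2 * Suc r)) > 0" "V > 0" "W > 0"
      unfolding V_def W_def by (rule qpoch_even_pos)+
    then have p: "V > 0" "W > 0" "1 - q\<^sup>2 * X > 0" "1 - q\<^sup>2 * (q ^ 4 * X * R\<^sup>2) > 0"
      unfolding E by (simp_all add: zero_less_mult_iff)
    have "(\<Sum>k\<le>Suc m. (1 - q ^ (2 * r + 1))\<^sup>2 * gauss_term q r k)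
        - (\<Sum>k<Suc m. (1 - q ^ (2 * Suc r + 1))\<^sup>2 * gauss_term q (Suc r) k)
      = (1 - q ^ (4 * r + 4)) * X * U\<^sup>2 / (V * W)
        + (1 - q ^ (2 * r + 1))\<^sup>2 * gauss_term q r (Suc m)
        - (1 - q ^ (2 * Suc r + 1))\<^sup>2 * gauss_term q (Suc r) m"
      using Suc.IH unfolding X_def[symmetric] U_def[symmetric] V_def[symmetric] W_def[symmetric]
      by (simp only: sum.atMost_Suc sum.lessThan_Suc)
    also have "\<dots> = (1 - R\<^sup>2 * q ^ 4) * X * U\<^sup>2 / (V * W)
        + (1 - q * R)\<^sup>2 * (U\<^sup>2 * (X * q\<^sup>2) / (V * (1 - q\<^sup>2 * X) * W))
        - (1 - q ^ 3 * R)\<^sup>2 * (U\<^sup>2 * X / (V * (W * (1 - q\<^sup>2 * (q ^ 4 * X * R\<^sup>2)))))"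
      unfolding gauss_term_def O E R X unfolding X_def[symmetric] V_def[symmetric] ..
    also have "\<dots> = (1 - R\<^sup>2 * q ^ 4) * (X * q\<^sup>2) * (U * (1 - q * (q\<^sup>2 * X * R)))\<^sup>2
        / (V * (1 - q\<^sup>2 * X) * (W * (1 - q\<^sup>2 * (q ^ 4 * X * R\<^sup>2))))"
    proof -
      define c d where "c = 1 - q\<^sup>2 * X" and "d = 1 - q\<^sup>2 * (q ^ 4 * X * R\<^sup>2)"
      have "(1 - R\<^sup>2 * q ^ 4) * X * U\<^sup>2 / (V * W)
        + (1 - q * R)\<^sup>2 * (U\<^sup>2 * (X * q\<^sup>2) / (V * c * W))
        - (1 - q ^ 3 * R)\<^sup>2 * (U\<^sup>2 * X / (V * (W * d)))
        = X * U\<^sup>2 * ((1 - R\<^sup>2 * q ^ 4) * c * d + (1 - q * R)\<^sup>2 * q\<^sup>2 * d - (1 - q ^ 3 * R)\<^sup>2 * c) / (V * c * (W * d))"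
        using p unfolding c_def[symmetric] d_def[symmetric]
        by (simp add: divide_simps) (simp add: algebra_simps)
      \<comment> \<open>With common factors and denominators removed, the certificate reduces to
        this polynomial identity in q, X and R.\<close>
      also have "(1 - R\<^sup>2 * q ^ 4) * c * d + (1 - q * R)\<^sup>2 * q\<^sup>2 * d - (1 - q ^ 3 * R)\<^sup>2 * c
         = (1 - R\<^sup>2 * q ^ 4) * q\<^sup>2 * (1 - q * (q\<^sup>2 * X * R))\<^sup>2"
        unfolding c_def d_def by algebra
      finally show ?thesis
        unfolding c_def[symmetric] d_def[symmetric] by (simp add: power_mult_distrib mult_ac)
    qed
    finally show ?case
      unfolding O E R X .
  }
qed

text \<open>By the certificate, \<open>?mu r * T r\<close> is constant in r. Its value is found by
  letting r grow: termwise bounds by multiples of Euler's series squeeze it to LO^2/LE^2, which is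
  1/psi(q)^2 by Gauss's product.\<close>

lemma sums_gauss_term:
  "gauss_term q r sums (1 / ((psi q)\<^sup>2 * (1 - q ^ (2 * r + 1))\<^sup>2))"
proof -
  let ?O = "qpoch q (q\<^sup>2)" and ?E = "qpoch (q\<^sup>2) (q\<^sup>2)"
  let ?mu = "\<lambda>r. (1 - q ^ (2 * r + 1))\<^sup>2"
  note q2 = power2_unit[OF q]
  obtain LE where LE: "LE > 0" "?E \<longlonglongrightarrow> LE" "\<And>n. LE \<le> ?E n"
    using qpoch_tendsto_pos[of "q\<^sup>2" "q\<^sup>2"] q2 by auto
  obtain LO where LO: "LO > 0" "?O \<longlonglongrightarrow> LO" "\<And>n. LO \<le> ?O n"
    using qpoch_tendsto_pos[of "q\<^sup>2" q] q2 q by auto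
  have "gauss_quot q \<longlonglongrightarrow> LE / LO"
    unfolding gauss_quot_def using LE LO by (intro tendsto_divide) auto
  then have psi: "psi q = LE / LO"
    using gauss_quot_tendsto_psi[OF q] LIMSEQ_unique by blast
  have euler: "(\<lambda>k. q ^ (2 * k) / ?E k) sums (1 / LE)"
    using sums_power_over_qpoch[of "q\<^sup>2", OF q2 LE(1,2)] by (simp add: power_mult)
  \<comment> \<open>Both products decrease in their length: the numerator is at most its value at k
    = 0 and the denominator at least its limit. \<open>lb\<close> exchanges these roles.\<close>
  have ub: "gauss_term q r k \<le> (?O r)\<^sup>2 / LE * (q ^ (2 * k) / ?E k)" for r k
  proof -
    have "?O (r + k) \<le> ?O r"
      using qpoch_antimono[of "q\<^sup>2" q r "r + k"] q2 q by simp
    then have "(?O (r + k))\<^sup>2 \<le> (?O r)\<^sup>2"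
      using qpoch_odd_pos[of "r + k"] by (intro power_mono) auto
    then have "(?O (r + k))\<^sup>2 / ?E (Suc (k + 2 * r)) \<le> (?O r)\<^sup>2 / LE"
      using LE by (intro frac_le) auto
    then have "(?O (r + k))\<^sup>2 / ?E (Suc (k + 2 * r)) * (q ^ (2 * k) / ?E k) \<le> (?O r)\<^sup>2 / LE * (q ^ (2 * k) / ?E k)"
      using q qpoch_even_pos[of k] by (intro mult_right_mono) auto
    then show ?thesis
      by (simp add: gauss_term_def mult_ac)
  qed
  have lb: "LO\<^sup>2 / ?E (Suc (2 * r)) * (q ^ (2 * k) / ?E k) \<le> gauss_term q r k" for r k
  proof -
    have "?E (Suc (k + 2 * r)) \<le> ?E (Suc (2 * r))"
      using q2 by (intro qpoch_antimono) auto
    moreover have "LO\<^sup>2 \<le> (?O (r + k))\<^sup>2"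
      using LO by (intro power_mono) auto
    ultimately have "LO\<^sup>2 / ?E (Suc (2 * r)) \<le> (?O (r + k))\<^sup>2 / ?E (Suc (k + 2 * r))"
      using qpoch_even_pos by (intro frac_le) auto
    then have "LO\<^sup>2 / ?E (Suc (2 * r)) * (q ^ (2 * k) / ?E k) \<le> (?O (r + k))\<^sup>2 / ?E (Suc (k + 2 * r)) * (q ^ (2 * k) / ?E k)"
      using q qpoch_even_pos[of k] by (intro mult_right_mono) auto
    then show ?thesis
      by (simp add: gauss_term_def mult_ac)
  qed
  have nonneg: "gauss_term q r k \<ge> 0" for r k
    unfolding gauss_term_def using qpoch_even_pos q by (intro divide_nonneg_pos mult_nonneg_nonneg mult_pos_pos) auto
  define T where "T r = (\<Sum>k. gauss_term q r k)" for r
  have T: "gauss_term q r sums T r" for r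
  proof -
    have "summable (\<lambda>k. (?O r)\<^sup>2 / LE * (q ^ (2 * k) / ?E k))"
      using euler by (intro summable_mult) (rule sums_summable)
    then have "summable (gauss_term q r)"
      by (rule summable_comparison_test'[of _ 0]) (use ub nonneg in simp)
    then show ?thesis
      by (simp add: T_def summable_sums)
  qed
  have const: "?mu r * T r = ?mu (Suc r) * T (Suc r)" for r
  proof -
    have 1: "(\<lambda>m. \<Sum>k\<le>m. ?mu r * gauss_term q r k) \<longlonglongrightarrow> ?mu r * T r"
      using sums_mult[OF T[of r], of "?mu r"] by (simp add: sums_def_le)
    have 2: "(\<lambda>m. \<Sum>k<m. ?mu (Suc r) * gauss_term q (Suc r) k) \<longlonglongrightarrow> ?mu (Suc r) * T (Suc r)"
      using sums_mult[OF T[of "Suc r"], of "?mu (Suc r)"] by (simp add: sums_def)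
    have 3: "(\<lambda>m. (1 - q ^ (4 * r + 4)) * q ^ (2 * m) * (?O (Suc (r + m)))\<^sup>2 / (?E m * ?E (Suc (Suc (m + 2 * r)))))
       \<longlonglongrightarrow> (1 - q ^ (4 * r + 4)) * 0 * LO\<^sup>2 / (LE * LE)"
    proof (intro tendsto_intros)
      have "(\<lambda>m. (q\<^sup>2) ^ m) \<longlonglongrightarrow> 0"
        using q2 by (intro LIMSEQ_power_zero) auto
      then show "(\<lambda>m. q ^ (2 * m)) \<longlonglongrightarrow> 0"
        by (simp add: power_mult)
      show "(\<lambda>m. ?O (Suc (r + m))) \<longlonglongrightarrow> LO"
        by (rule filterlim_compose[OF LO(2)]) (auto intro!: filterlim_subseq simp: strict_mono_def)
      show "(\<lambda>m. ?E (Suc (Suc (m + 2 * r)))) \<longlonglongrightarrow> LE"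
        by (rule filterlim_compose[OF LE(2)]) (auto intro!: filterlim_subseq simp: strict_mono_def)
    qed (use LE in auto)
    have "?mu r * T r - ?mu (Suc r) * T (Suc r) = (1 - q ^ (4 * r + 4)) * 0 * LO\<^sup>2 / (LE * LE)"
      using LIMSEQ_unique[OF tendsto_diff[OF 1 2, unfolded gauss_term_telescope] 3] .
    then show ?thesis
      by simp
  qed
  have const': "?mu r * T r = ?mu 0 * T 0" for r
    by (induction r) (use const in auto)
  have mu: "?mu \<longlonglongrightarrow> (1 - q * 0)\<^sup>2"
  proof -
    have "(\<lambda>m. (q\<^sup>2) ^ m) \<longlonglongrightarrow> 0"
      using q2 by (intro LIMSEQ_power_zero) auto
    then have "(\<lambda>r. (1 - q * (q\<^sup>2) ^ r)\<^sup>2) \<longlonglongrightarrow> (1 - q * 0)\<^sup>2"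
      by (intro tendsto_power tendsto_diff tendsto_mult tendsto_const)
    then show ?thesis
      by (simp add: power_mult)
  qed
  \<comment> \<open>The upper bound converges to LO^2/LE^2 as r grows, and the lower bound treated
    below has the same limit.\<close>
  have "(\<lambda>r. ?mu r * ((?O r)\<^sup>2 / LE * (1 / LE))) \<longlonglongrightarrow> (1 - q * 0)\<^sup>2 * (LO\<^sup>2 / LE * (1 / LE))"
    using LE LO by (intro tendsto_intros mu) auto
  moreover have "?mu 0 * T 0 \<le> ?mu r * ((?O r)\<^sup>2 / LE * (1 / LE))" for r
    unfolding const'[of r, symmetric]
    by (intro mult_left_mono sums_le[OF _ T sums_mult[OF euler]] ub) auto
  ultimately have le: "?mu 0 * T 0 \<le> LO\<^sup>2 / LE * (1 / LE)"
    by (intro LIMSEQ_le_const) auto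
  have "(\<lambda>r. ?E (Suc (2 * r))) \<longlonglongrightarrow> LE"
    by (rule filterlim_compose[OF LE(2)]) (auto intro!: filterlim_subseq simp: strict_mono_def)
  then have "(\<lambda>r. ?mu r * (LO\<^sup>2 / ?E (Suc (2 * r)) * (1 / LE))) \<longlonglongrightarrow> (1 - q * 0)\<^sup>2 * (LO\<^sup>2 / LE * (1 / LE))"
    using LE LO by (intro tendsto_intros mu) auto
  moreover have "?mu r * (LO\<^sup>2 / ?E (Suc (2 * r)) * (1 / LE)) \<le> ?mu 0 * T 0" for r
    unfolding const'[of r, symmetric]
    by (intro mult_left_mono sums_le[OF _ sums_mult[OF euler] T] lb) auto
  ultimately have "LO\<^sup>2 / LE * (1 / LE) \<le> ?mu 0 * T 0"
    by (intro LIMSEQ_le_const2) auto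
  with le have "?mu r * T r = 1 / (psi q)\<^sup>2"
    unfolding const'[of r] psi by (simp add: power_divide power2_eq_square)
  moreover have "?mu r > 0"
    using power_pos_less_one[OF q, of "2 * r + 1"] by simp
  ultimately have "T r = 1 / ((psi q)\<^sup>2 * ?mu r)"
    using psi_pos[OF q] by (simp add: field_simps)
  then show ?thesis
    using T[of r] by simp
qed

end

section \<open>Comparing exponents of power series\<close>

text \<open>Tonelli's theorem for discrete sums: for nonnegative terms the iterated sum already
  yields summability over all pairs.\<close>

lemma has_sum_SigmaI_nonneg:
  fixes f :: "'a \<times> 'b \<Rightarrow> real"
  assumes "\<And>x. x \<in> A \<Longrightarrow> ((\<lambda>y. f (x, y)) has_sum g x) (B x)" "(g has_sum S) A"
    and "\<And>x y. x \<in> A \<Longrightarrow> y \<in> B x \<Longrightarrow> f (x, y) \<ge> 0"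
  shows "(f has_sum S) (Sigma A B)"
  using assms by (intro has_sum_SigmaI[of A f B g] summable_on_SigmaI[of A f B g])
    (auto dest: has_sum_imp_summable)

text \<open>Once the coefficients of the difference below m are known to vanish, division by x^m
  leaves a series whose constant term is its limit for x tending to 0 from the right.\<close>

lemma powser_unique:
  fixes a b :: "nat \<Rightarrow> real"
  assumes "\<And>x. 0 < x \<Longrightarrow> x < 1 \<Longrightarrow> (\<lambda>n. a n * x ^ n) sums F x"
    and "\<And>x. 0 < x \<Longrightarrow> x < 1 \<Longrightarrow> (\<lambda>n. b n * x ^ n) sums F x"
  shows "a = b"
proof
  fix m
  define c where "c n = a n - b n" for n
  have c: "(\<lambda>n. c n * x ^ n) sums 0" if "0 < x" "x < 1" for x
    using sums_diff[OF assms[OF that]] by (simp add: c_def algebra_simps)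
  have "c m = 0"
  proof (induction m rule: less_induct)
    case (less m)
    define d where "d n = c (n + m)" for n
    have d: "(\<lambda>n. d n * x ^ n) sums 0" if x: "0 < x" "x < 1" for x
    proof -
      have "(\<lambda>n. c (n + m) * x ^ (n + m)) sums (0 - (\<Sum>n<m. c n * x ^ n))"
        using c[OF x] by (rule sums_split_initial_segment)
      then have "(\<lambda>n. x ^ m * (d n * x ^ n)) sums (x ^ m * 0)"
        using less by (simp add: d_def power_add mult_ac)
      then show ?thesis
        using x by (subst (asm) sums_mult_iff) auto
    qed
    \<comment> \<open>Convergence at 1/2 puts 0 inside the disc of convergence, which makes the
      series continuous there.\<close>
    have s: "summable (\<lambda>n. d n * (1/2) ^ n)"
      using d[of "1/2"] by (simp add: sums_iff)
    have "isCont (\<lambda>x. \<Sum>n. d n * x ^ n) 0"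
      by (rule isCont_powser[OF s]) simp
    then have "((\<lambda>x. \<Sum>n. d n * x ^ n) \<longlongrightarrow> d 0) (at_right 0)"
      by (simp add: isCont_def filterlim_at_split)
    moreover have "eventually (\<lambda>x. (\<Sum>n. d n * x ^ n) = 0) (at_right 0)"
      by (rule eventually_mono[OF eventually_at_right_real[of 0 1]]) (use d in \<open>auto simp: sums_iff\<close>)
    then have "((\<lambda>x. \<Sum>n. d n * x ^ n) \<longlongrightarrow> 0) (at_right 0)"
      by (rule tendsto_eventually)
    ultimately have "d 0 = 0"
      by (rule tendsto_unique[rotated]) simp
    then show ?case
      by (simp add: d_def)
  qed
  then show "a m = b m"
    by (simp add: c_def)
qed

text \<open>On a fibre of \<open>e\<close> the power of x is a nonzero constant, which
  cancels.\<close>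

lemma summable_on_fibre:
  fixes w :: "'a \<Rightarrow> real"
  assumes "(\<lambda>i. w i * x ^ e i) summable_on A" "x \<noteq> 0"
  shows "w summable_on {i\<in>A. e i = n}"
proof -
  have "(\<lambda>i. w i * x ^ e i) summable_on {i\<in>A. e i = n}"
    using assms(1) by (rule summable_on_subset) auto
  also have "?this \<longleftrightarrow> (\<lambda>i. w i * x ^ n) summable_on {i\<in>A. e i = n}"
    by (rule summable_on_cong) simp
  finally show ?thesis
    using \<open>x \<noteq> 0\<close> by (subst (asm) summable_on_cmult_left') auto
qed

text \<open>Grouping the family by exponent turns it into an ordinary power series, whose
  coefficients are the fibre sums.\<close>

lemma has_sum_powers_imp_powser:
  fixes w :: "'a \<Rightarrow> real" and e :: "'a \<Rightarrow> nat"
  assumes "\<And>x. 0 < x \<Longrightarrow> x < 1 \<Longrightarrow> ((\<lambda>i. w i * x ^ e i) has_sum F x) A"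
    and "0 < x" "x < 1"
  shows "(\<lambda>n. (\<Sum>\<^sub>\<infinity>i\<in>{i\<in>A. e i = n}. w i) * x ^ n) sums F x"
proof -
  have summable: "w summable_on {i\<in>A. e i = n}" for n
    using assms(1)[of "1/2"] by (intro summable_on_fibre[of w "1/2" e]) (auto dest: has_sum_imp_summable)
  have "bij_betw snd (Sigma UNIV (\<lambda>n. {i\<in>A. e i = n})) A"
    by (rule bij_betwI[of _ _ _ "\<lambda>i. (e i, i)"]) auto
  then have "((\<lambda>p. w (snd p) * x ^ e (snd p)) has_sum F x) (Sigma UNIV (\<lambda>n. {i\<in>A. e i = n}))"
    using assms by (subst has_sum_reindex_bij_betw[where g = snd and f = "\<lambda>i. w i * x ^ e i"]) auto
  then have "((\<lambda>n. (\<Sum>\<^sub>\<infinity>i\<in>{i\<in>A. e i = n}. w i) * x ^ n) has_sum F x) UNIV"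
  proof (rule has_sum_SigmaD)
    fix n
    have "((\<lambda>i. w i * x ^ n) has_sum (\<Sum>\<^sub>\<infinity>i\<in>{i\<in>A. e i = n}. w i) * x ^ n) {i\<in>A. e i = n}"
      using summable by (intro has_sum_cmult_left has_sum_infsum)
    then show "((\<lambda>i. w (snd (n, i)) * x ^ e (snd (n, i))) has_sum (\<Sum>\<^sub>\<infinity>i\<in>{i\<in>A. e i = n}. w i) * x ^ n)
        {i\<in>A. e i = n}"
      by (subst has_sum_cong[of _ _ "\<lambda>i. w i * x ^ n"]) auto
  qed
  then show ?thesis
    by (rule has_sum_imp_sums)
qed

text \<open>If no index in \<open>B\<close> had exponent \<open>e i\<close>, that coefficient would
  be an empty sum on one side, whereas on the other it is a sum of nonnegative weights that includes
  the positive \<open>w i\<close>.\<close>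

lemma exponent_occurs:
  fixes w :: "'a \<Rightarrow> real" and u :: "'b \<Rightarrow> real"
  assumes "\<And>x. 0 < x \<Longrightarrow> x < 1 \<Longrightarrow> ((\<lambda>i. w i * x ^ e i) has_sum F x) A"
    and "\<And>x. 0 < x \<Longrightarrow> x < 1 \<Longrightarrow> ((\<lambda>j. u j * x ^ d j) has_sum F x) B"
    and "\<And>i. i \<in> A \<Longrightarrow> w i \<ge> 0" and i: "i \<in> A" "w i > 0"
  shows "\<exists>j\<in>B. d j = e i"
proof (rule ccontr)
  assume "\<not> ?thesis"
  then have "{j\<in>B. d j = e i} = {}"
    by auto
  moreover have "(\<lambda>n. \<Sum>\<^sub>\<infinity>i\<in>{i\<in>A. e i = n}. w i) = (\<lambda>n. \<Sum>\<^sub>\<infinity>j\<in>{j\<in>B. d j = n}. u j)"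
    using has_sum_powers_imp_powser[OF assms(1)] has_sum_powers_imp_powser[OF assms(2)]
    by (rule powser_unique)
  ultimately have "(\<Sum>\<^sub>\<infinity>i'\<in>{i'\<in>A. e i' = e i}. w i') = 0"
    by (metis infsum_empty)
  moreover have "w summable_on {i'\<in>A. e i' = e i}"
    using assms(1)[of "1/2"] by (intro summable_on_fibre[of w "1/2" e]) (auto dest: has_sum_imp_summable)
  ultimately show False
    using nonneg_infsum_le_0D[of w "{i'\<in>A. e i' = e i}" i] assms(3) i by auto
qed

section \<open>The Hecke-type expansion\<close>

text \<open>The inner sum of q^(-j^2) over the integers |j| \<le> r in the Hecke-type
  expansion.\<close>

definition partial_theta :: "real \<Rightarrow> nat \<Rightarrow> real" where
  "partial_theta q r = (\<Sum>j\<le>r. eps j / q ^ j\<^sup>2)"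

text \<open>Twice the geometric series less 1. It later expands the quotient in the Hecke-type sum
  with positive coefficients.\<close>

lemma eps_geometric_sums:
  fixes y :: real
  assumes "0 \<le> y" "y < 1"
  shows "(\<lambda>k. eps k * y ^ k) sums ((1 + y) / (1 - y))"
proof -
  have "(\<lambda>k. 2 * y ^ k - (if k = 0 then 1 else 0)) sums (2 * (1 / (1 - y)) - 1)"
    using assms by (intro sums_diff sums_mult geometric_sums sums_single) auto
  moreover have "2 * y ^ k - (if k = 0 then 1 else 0) = eps k * y ^ k" for k
    by (simp add: eps_def)
  moreover have "2 * (1 / (1 - y)) - 1 = (1 + y) / (1 - y)"
    using assms by (simp add: field_simps)
  ultimately show ?thesis
    by simp
qed

context
  fixes q :: real
  assumes q: "0 < q" "q < 1"
begin

lemma partial_theta_nonneg: "partial_theta q r \<ge> 0"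
  using q by (simp add: partial_theta_def sum_nonneg)

text \<open>Interchanging the sums over j \<le> r \<le> n makes the sum over r telescope, and the
  finite triple product evaluates the rest. For a = q^2 the usual (q^4; q^2)_(n+r) is (q^2;
  q^2)_(n+r+1)/(1 - q^2); the constant is absorbed into the first member of the pair.\<close>

lemma bailey_pair:
  "(\<Sum>r\<le>n. q ^ (2 * r\<^sup>2) * (1 - q ^ (4 * r + 2)) * partial_theta q r
      / (qpoch (q\<^sup>2) (q\<^sup>2) (n - r) * qpoch (q\<^sup>2) (q\<^sup>2) (Suc (n + r))))
   = (qpoch (- q) (q\<^sup>2) n)\<^sup>2 / qpoch (q\<^sup>2) (q\<^sup>2) (2 * n)"
proof -
  let ?E = "qpoch (q\<^sup>2) (q\<^sup>2)"
  let ?h = "\<lambda>r. q ^ (2 * r\<^sup>2) * (1 - q ^ (4 * r + 2)) / (?E (n - r) * ?E (Suc (n + r)))"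
  have "(\<Sum>r\<le>n. q ^ (2 * r\<^sup>2) * (1 - q ^ (4 * r + 2)) * partial_theta q r / (?E (n - r) * ?E (Suc (n + r))))
      = (\<Sum>r\<le>n. \<Sum>j\<le>r. eps j / q ^ j\<^sup>2 * ?h r)"
    by (simp add: partial_theta_def sum_distrib_left sum_distrib_right sum_divide_distrib mult_ac)
  also have "\<dots> = (\<Sum>r\<le>n. \<Sum>j | j \<in> {..n} \<and> j \<le> r. eps j / q ^ j\<^sup>2 * ?h r)"
    by (intro sum.cong refl) auto
  also have "\<dots> = (\<Sum>j\<le>n. \<Sum>r | r \<in> {..n} \<and> j \<le> r. eps j / q ^ j\<^sup>2 * ?h r)"
    by (rule sum.swap_restrict) auto
  also have "\<dots> = (\<Sum>j\<le>n. eps j * (q ^ j\<^sup>2 / (?E (n - j) * ?E (n + j))))"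
  proof (rule sum.cong)
    fix j assume "j \<in> {..n}"
    then have j: "j \<le> n"
      by simp
    have "{r. r \<in> {..n} \<and> j \<le> r} = {j..n}"
      by auto
    then have "(\<Sum>r | r \<in> {..n} \<and> j \<le> r. eps j / q ^ j\<^sup>2 * ?h r) = eps j / q ^ j\<^sup>2 * (\<Sum>r=j..n. ?h r)"
      by (simp add: sum_distrib_left)
    also have "\<dots> = eps j / q ^ j\<^sup>2 * (q ^ (2 * j\<^sup>2) / (?E (n - j) * ?E (n + j)))"
      unfolding sum_telescope_kernel[OF q j] ..
    also have "q ^ (2 * j\<^sup>2) = q ^ j\<^sup>2 * q ^ j\<^sup>2"
      by (simp add: mult_2 power_add)
    finally show "(\<Sum>r | r \<in> {..n} \<and> j \<le> r. eps j / q ^ j\<^sup>2 * ?h r)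
        = eps j * (q ^ j\<^sup>2 / (?E (n - j) * ?E (n + j)))"
      using q by simp
  qed simp
  finally show ?thesis
    using finite_triple_product[OF q] by simp
qed

lemma qpoch_odd_mult_qpoch_neg:
  "qpoch q (q\<^sup>2) n * qpoch (- q) (q\<^sup>2) n = qpoch (q\<^sup>2) ((q\<^sup>2)\<^sup>2) n"
proof -
  have "(1 - q * (q\<^sup>2) ^ i) * (1 - - q * (q\<^sup>2) ^ i) = 1 - q\<^sup>2 * ((q\<^sup>2)\<^sup>2) ^ i" for i
  proof -
    have "((q\<^sup>2)\<^sup>2) ^ i = ((q\<^sup>2) ^ i)\<^sup>2"
      by (metis mult.commute power_mult)
    then show ?thesis
      by (simp add: power2_eq_square algebra_simps)
  qed
  then show ?thesis
    by (simp only: qpoch_def prod.distrib[symmetric])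
qed

text \<open>The factors 1 - a^i with i odd and with i even are separated.\<close>

lemma qpoch_double: "qpoch a a (2 * n) = qpoch a (a\<^sup>2) n * qpoch (a\<^sup>2) (a\<^sup>2) n"
  for a :: real
proof (induction n)
  case (Suc n)
  have 1: "a * (a\<^sup>2) ^ n = a * a ^ (2 * n)" "a\<^sup>2 * (a\<^sup>2) ^ n = a * a ^ Suc (2 * n)"
    by (simp_all add: power_mult power2_eq_square)
  have 2: "2 * Suc n = Suc (Suc (2 * n))"
    by simp
  show ?case
    unfolding 2 qpoch_Suc Suc.IH 1 by (simp only: mult_ac)
qed simp

text \<open>The weight of Bailey's lemma at both parameters q, times the second member of the pair.
  Pairing 1 - y with 1 + y gives (q^2; q^4)_n squared, one copy of which cancels against (q^2;
  q^2)_(2n).\<close>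

lemma bailey_weight:
  "(qpoch q (q\<^sup>2) n)\<^sup>2 * q ^ (2 * n) * ((qpoch (- q) (q\<^sup>2) n)\<^sup>2 / qpoch (q\<^sup>2) (q\<^sup>2) (2 * n))
   = (q\<^sup>2) ^ n / gauss_quot (q\<^sup>2) n"
proof -
  let ?A = "qpoch (q\<^sup>2) ((q\<^sup>2)\<^sup>2) n" and ?B = "qpoch ((q\<^sup>2)\<^sup>2) ((q\<^sup>2)\<^sup>2) n"
  have "0 \<le> (q\<^sup>2)\<^sup>2" "(q\<^sup>2)\<^sup>2 < 1" "q\<^sup>2 < 1"
    using power2_unit[OF q] power2_unit[of "q\<^sup>2"] q by auto
  then have "?A > 0"
    by (intro qpoch_pos)
  have "(qpoch q (q\<^sup>2) n)\<^sup>2 * q ^ (2 * n) * ((qpoch (- q) (q\<^sup>2) n)\<^sup>2 / qpoch (q\<^sup>2) (q\<^sup>2) (2 * n))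
      = (qpoch q (q\<^sup>2) n * qpoch (- q) (q\<^sup>2) n)\<^sup>2 * (q\<^sup>2) ^ n / qpoch (q\<^sup>2) (q\<^sup>2) (2 * n)"
    by (simp add: power_mult_distrib power_mult)
  also have "\<dots> = ?A\<^sup>2 * (q\<^sup>2) ^ n / (?A * ?B)"
    unfolding qpoch_odd_mult_qpoch_neg qpoch_double[of "q\<^sup>2"] ..
  also have "\<dots> = (q\<^sup>2) ^ n / gauss_quot (q\<^sup>2) n"
    using \<open>?A > 0\<close> by (simp add: gauss_quot_def power2_eq_square)
  finally show ?thesis .
qed

text \<open>The double sum of f(n, r) over r \<le> n is evaluated in two orders: summing over r
  first gives psi(q^2) by the Bailey pair, summing over n first gives the q-Gauss sums, each with a
  factor 1/psi(q)^2.\<close>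

lemma psi_product_expansion:
  "((\<lambda>r. q ^ (2 * r\<^sup>2 + 2 * r) * ((1 + q ^ (2 * r + 1)) / (1 - q ^ (2 * r + 1))) * partial_theta q r)
     has_sum (psi q)\<^sup>2 * psi (q\<^sup>2)) UNIV"
proof -
  let ?E = "qpoch (q\<^sup>2) (q\<^sup>2)" and ?O = "qpoch q (q\<^sup>2)"
  define a where "a r = q ^ (2 * r\<^sup>2) * (1 - q ^ (4 * r + 2)) * partial_theta q r" for r
  define f where "f = (\<lambda>(n, r). (?O n)\<^sup>2 * q ^ (2 * n) * (a r / (?E (n - r) * ?E (Suc (n + r)))))"
  have a: "a r \<ge> 0" for r
    using q partial_theta_nonneg[of r] power_pos_less_one[OF q, of "4 * r + 2"] by (simp add: a_def)
  have f: "f (n, r) \<ge> 0" for n r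
    unfolding f_def using a[of r] q qpoch_even_pos[OF q] by (simp add: less_imp_le)
  have q2: "0 < q\<^sup>2" "q\<^sup>2 < 1"
    using q power2_unit[OF q] by auto
  have "(f has_sum psi (q\<^sup>2)) (SIGMA n:UNIV. {..n})"
  proof (rule has_sum_SigmaI_nonneg)
    fix n
    have "(\<Sum>r\<le>n. f (n, r)) = (q\<^sup>2) ^ n / gauss_quot (q\<^sup>2) n"
      unfolding f_def prod.case sum_distrib_left[symmetric] a_def bailey_pair bailey_weight ..
    then show "((\<lambda>r. f (n, r)) has_sum ((q\<^sup>2) ^ n / gauss_quot (q\<^sup>2) n)) {..n}"
      by (intro has_sum_finiteI) auto
  next
    show "((\<lambda>n. (q\<^sup>2) ^ n / gauss_quot (q\<^sup>2) n) has_sum psi (q\<^sup>2)) UNIV"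
      using gauss_quot_pos[OF q2] q2
      by (intro sums_nonneg_imp_has_sum sums_power_over_gauss_quot) (auto simp: less_imp_le)
  qed (rule f)
  \<comment> \<open>The substitution n = r + k turns the triangle r \<le> n into all pairs (r,
    k).\<close>
  moreover have "bij_betw (\<lambda>(r :: nat, k). (r + k, r)) UNIV (SIGMA n:UNIV. {..n})"
    by (rule bij_betwI[of _ _ _ "\<lambda>(n, r). (r, n - r)"]) auto
  ultimately have "((\<lambda>(r, k). f (r + k, r)) has_sum psi (q\<^sup>2)) (UNIV \<times> UNIV)"
    by (subst (asm) has_sum_reindex_bij_betw[symmetric]) (auto simp: case_prod_unfold)
  then have "((\<lambda>r. a r * q ^ (2 * r) * (1 / ((psi q)\<^sup>2 * (1 - q ^ (2 * r + 1))\<^sup>2))) has_sum psi (q\<^sup>2)) UNIV"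
  proof (rule has_sum_SigmaD)
    fix r
    have "f (r + k, r) = a r * q ^ (2 * r) * gauss_term q r k" for k
    proof -
      have 1: "r + k + r = k + 2 * r" "r + k - r = k" "q ^ (2 * (r + k)) = q ^ (2 * r) * q ^ (2 * k)"
        by (simp_all add: power_add)
      show ?thesis
        unfolding f_def gauss_term_def prod.case 1 by simp
    qed
    moreover have "((\<lambda>k. a r * q ^ (2 * r) * gauss_term q r k)
        has_sum a r * q ^ (2 * r) * (1 / ((psi q)\<^sup>2 * (1 - q ^ (2 * r + 1))\<^sup>2))) UNIV"
    proof (intro sums_nonneg_imp_has_sum sums_mult sums_gauss_term[OF q])
      show "0 \<le> a r * q ^ (2 * r) * gauss_term q r k" for k
        using a[of r] q qpoch_even_pos[OF q] by (simp add: gauss_term_def less_imp_le)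
    qed
    ultimately show "((\<lambda>k. case (r, k) of (r, k) \<Rightarrow> f (r + k, r))
        has_sum a r * q ^ (2 * r) * (1 / ((psi q)\<^sup>2 * (1 - q ^ (2 * r + 1))\<^sup>2))) UNIV"
      by simp
  qed
  then have "((\<lambda>r. (psi q)\<^sup>2 * (a r * q ^ (2 * r) * (1 / ((psi q)\<^sup>2 * (1 - q ^ (2 * r + 1))\<^sup>2))))
      has_sum (psi q)\<^sup>2 * psi (q\<^sup>2)) UNIV"
    by (rule has_sum_cmult_right)
  moreover have "(psi q)\<^sup>2 * (a r * q ^ (2 * r) * (1 / ((psi q)\<^sup>2 * (1 - q ^ (2 * r + 1))\<^sup>2)))
      = q ^ (2 * r\<^sup>2 + 2 * r) * ((1 + q ^ (2 * r + 1)) / (1 - q ^ (2 * r + 1))) * partial_theta q r" for r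
  proof -
    define y where "y = q ^ (2 * r + 1)"
    have "1 - y > 0"
      using power_pos_less_one[OF q, of "2 * r + 1"] by (simp add: y_def)
    have "4 * r + 2 = (2 * r + 1) * 2"
      by simp
    then have "q ^ (4 * r + 2) = y\<^sup>2"
      unfolding y_def by (simp only: power_mult)
    \<comment> \<open>The factor 1 - y cancels one of the two in the denominator of the q-Gauss sum,
      which leaves (1 + y)/(1 - y).\<close>
    then have 1: "1 - q ^ (4 * r + 2) = (1 - y) * (1 + y)"
      by (simp only: power2_eq_square) (simp add: algebra_simps)
    show ?thesis
      using psi_pos[OF q] \<open>1 - y > 0\<close> unfolding a_def y_def[symmetric] 1 power_add[of q "2 * r\<^sup>2"]
      by (simp add: power2_eq_square)
  qed
  ultimately show ?thesis
    by simp
qed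

section \<open>Both sides of the expansion as families of powers of q\<close>

lemma psi_product_expansion_powers:
  "((\<lambda>(r, j, k). real (eps j * eps k) * q ^ (2 * r\<^sup>2 + 2 * r - j\<^sup>2 + (2 * r + 1) * k))
     has_sum (psi q)\<^sup>2 * psi (q\<^sup>2)) (SIGMA r:UNIV. {..r} \<times> UNIV)"
proof (rule has_sum_SigmaI_nonneg[OF _ psi_product_expansion])
  fix r :: nat
  let ?w = "(1 + q ^ (2 * r + 1)) / (1 - q ^ (2 * r + 1))"
  let ?c = "\<lambda>j. q ^ (2 * r\<^sup>2 + 2 * r - j\<^sup>2)"
  have "((\<lambda>(j, k). real (eps j * eps k) * q ^ (2 * r\<^sup>2 + 2 * r - j\<^sup>2 + (2 * r + 1) * k))
      has_sum (\<Sum>j\<le>r. eps j * ?c j * ?w)) ({..r} \<times> UNIV)"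
  proof (rule has_sum_SigmaI_nonneg)
    fix j
    have "(\<lambda>k. eps k * (q ^ (2 * r + 1)) ^ k) sums ?w"
      using q power_pos_less_one[OF q, of "2 * r + 1"] by (intro eps_geometric_sums) auto
    then have "(\<lambda>k. eps j * ?c j * (eps k * (q ^ (2 * r + 1)) ^ k)) sums (eps j * ?c j * ?w)"
      by (rule sums_mult)
    then have "((\<lambda>k. eps j * ?c j * (eps k * (q ^ (2 * r + 1)) ^ k)) has_sum (eps j * ?c j * ?w)) UNIV"
      by (rule sums_nonneg_imp_has_sum) (use q in simp)
    then show "((\<lambda>k. case (j, k) of (j, k) \<Rightarrow> real (eps j * eps k) * q ^ (2 * r\<^sup>2 + 2 * r - j\<^sup>2 + (2 * r + 1) * k))
        has_sum eps j * ?c j * ?w) UNIV"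
      unfolding prod.case power_add power_mult of_nat_mult by (simp add: mult_ac)
  qed (use q in \<open>auto intro!: has_sum_finite\<close>)
  also have "(\<Sum>j\<le>r. eps j * ?c j * ?w) = q ^ (2 * r\<^sup>2 + 2 * r) * ?w * partial_theta q r"
    unfolding partial_theta_def sum_distrib_left
  proof (rule sum.cong)
    fix j assume "j \<in> {..r}"
    \<comment> \<open>This makes the natural-number subtraction in the exponent exact.\<close>
    then have "j\<^sup>2 \<le> 2 * r\<^sup>2 + 2 * r"
    proof -
      have "j\<^sup>2 \<le> r\<^sup>2"
        using \<open>j \<in> {..r}\<close> by (intro power_mono) auto
      then show ?thesis
        by linarith
    qed
    then have "?c j = q ^ (2 * r\<^sup>2 + 2 * r) / q ^ j\<^sup>2"
      using q by (intro power_diff) auto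
    then show "eps j * ?c j * ?w = q ^ (2 * r\<^sup>2 + 2 * r) * ?w * (eps j / q ^ j\<^sup>2)"
      by (simp add: mult_ac)
  qed simp
  finally show "((\<lambda>p. case (r, p) of (r, j, k) \<Rightarrow> real (eps j * eps k) * q ^ (2 * r\<^sup>2 + 2 * r - j\<^sup>2 + (2 * r + 1) * k))
      has_sum q ^ (2 * r\<^sup>2 + 2 * r) * ?w * partial_theta q r) ({..r} \<times> UNIV)"
    by simp
qed (use q in auto)

lemma psi_product_powers:
  "((\<lambda>(a, b, c). q ^ (triangle a + triangle b + 2 * triangle c)) has_sum (psi q)\<^sup>2 * psi (q\<^sup>2)) UNIV"
proof -
  have psi: "((\<lambda>k. x ^ triangle k) has_sum psi x) UNIV" if "0 < x" "x < 1" for x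
    using psi_sums[OF that] that by (intro sums_nonneg_imp_has_sum) auto
  have q2: "0 < q\<^sup>2" "q\<^sup>2 < 1"
    using q power2_unit[OF q] by auto
  have "((\<lambda>(a, b, c). q ^ (triangle a + triangle b + 2 * triangle c)) has_sum psi q * (psi q * psi (q\<^sup>2)))
      (UNIV \<times> UNIV \<times> UNIV)"
  proof (rule has_sum_SigmaI_nonneg)
    show "((\<lambda>a. q ^ triangle a * (psi q * psi (q\<^sup>2))) has_sum psi q * (psi q * psi (q\<^sup>2))) UNIV"
      by (rule has_sum_cmult_left[OF psi[OF q]])
    fix a
    have "((\<lambda>(b, c). q ^ triangle b * (q\<^sup>2) ^ triangle c) has_sum psi q * psi (q\<^sup>2)) (UNIV \<times> UNIV)"
      using has_sum_SigmaI_nonneg[OF _ has_sum_cmult_left[OF psi[OF q], of "psi (q\<^sup>2)"],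
          of "\<lambda>(b, c). q ^ triangle b * (q\<^sup>2) ^ triangle c" "\<lambda>_. UNIV"]
        has_sum_cmult_right[OF psi[OF q2]] q by auto
    then have "((\<lambda>p. q ^ triangle a * (case p of (b, c) \<Rightarrow> q ^ triangle b * (q\<^sup>2) ^ triangle c))
        has_sum q ^ triangle a * (psi q * psi (q\<^sup>2))) (UNIV \<times> UNIV)"
      by (rule has_sum_cmult_right)
    then show "((\<lambda>p. case (a, p) of (a, b, c) \<Rightarrow> q ^ (triangle a + triangle b + 2 * triangle c))
        has_sum q ^ triangle a * (psi q * psi (q\<^sup>2))) (UNIV \<times> UNIV)"
      by (simp add: case_prod_unfold power_add power_mult mult.assoc)
  qed (use q in auto)
  then show ?thesis
    by (simp add: power2_eq_square mult.assoc)
qed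

end

section \<open>Propus parameter sets\<close>

text \<open>The two families of powers have the same sum for all 0 < x < 1, so each exponent on the
  Hecke side, where all weights are positive, occurs on the triangular side.\<close>

lemma sum_triangles:
  obtains a b c where "n = triangle a + triangle b + 2 * triangle c"
proof -
  let ?e = "\<lambda>(r, j, k). 2 * r\<^sup>2 + 2 * r - j\<^sup>2 + (2 * r + 1) * k :: nat"
  let ?d = "\<lambda>(a, b, c). triangle a + triangle b + 2 * triangle c"
  \<comment> \<open>The index r = j = 0, k = n has exponent n.\<close>
  have "\<exists>p\<in>UNIV. ?d p = ?e (0, 0, n)"
  proof (rule exponent_occurs[where w = "\<lambda>(r, j, k). real (eps j * eps k)" and u = "\<lambda>_. 1"
        and e = ?e and d = ?d and A = "SIGMA r:UNIV. {..r} \<times> UNIV" and i = "(0, 0, n)"])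
    fix x :: real
    assume x: "0 < x" "x < 1"
    show "((\<lambda>i. (case i of (r, j, k) \<Rightarrow> real (eps j * eps k))
        * x ^ (case i of (r, j, k) \<Rightarrow> 2 * r\<^sup>2 + 2 * r - j\<^sup>2 + (2 * r + 1) * k))
        has_sum (psi x)\<^sup>2 * psi (x\<^sup>2)) (SIGMA r:UNIV. {..r} \<times> UNIV)"
      using psi_product_expansion_powers[OF x] by (simp add: case_prod_unfold)
    show "((\<lambda>i. 1 * x ^ (case i of (a, b, c) \<Rightarrow> triangle a + triangle b + 2 * triangle c))
        has_sum (psi x)\<^sup>2 * psi (x\<^sup>2)) UNIV"
      using psi_product_powers[OF x] by (simp add: case_prod_unfold)
  qed auto
  then show ?thesis
    using that by auto
qed

theorem theorem1:
  fixes v :: int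
  assumes "odd v" and "v > 1"
  shows "\<exists>x y z l :: int.
           0 \<le> x \<and> real_of_int x < real_of_int v / 2 \<and>
           0 \<le> y \<and> real_of_int y < real_of_int v / 2 \<and>
           0 \<le> z \<and> real_of_int z < real_of_int v / 2 \<and>
           l \<ge> 0 \<and> propus_parameter_set v x y y z l"
proof -
  obtain m where "v = 2 * m + 1"
    using \<open>odd v\<close> by (rule oddE)
  then obtain n :: nat where v: "v = 2 * int n + 1"
    using \<open>v > 1\<close> zero_le_imp_eq_int[of m] by auto
  obtain a b c where n: "n = triangle a + triangle c + 2 * triangle b"
    by (rule sum_triangles)
  have le: "a \<le> n" "b \<le> n" "c \<le> n"
    using triangle_ge[of a] triangle_ge[of b] triangle_ge[of c] n by linarith+
  \<comment> \<open>Completing the squares calls for v - 2x = 2a + 1, and likewise for y and z; the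
    positive sign puts the three numbers below v/2. The doubled triangular number belongs to
    y.\<close>
  define x y z where "x = int n - int a" and "y = int n - int b" and "z = int n - int c"
  define l where "l = x + 2 * y + z - v"
  have "2 * int n = int (2 * triangle a) + int (2 * triangle c) + 2 * int (2 * triangle b)"
    using n by simp
  then have n2: "2 * int n = int a * (int a + 1) + int c * (int c + 1) + 2 * (int b * (int b + 1))"
    unfolding triangle_double by (simp add: algebra_simps)
  have eq: "x * (x - 1) + y * (y - 1) + y * (y - 1) + z * (z - 1) = l * (v - 1)"
    using n2 unfolding l_def x_def y_def z_def v by (simp add: algebra_simps)
  have nonneg: "k * (k - 1) \<ge> 0" for k :: int
    by (cases "k \<le> 0") (auto intro: mult_nonpos_nonpos)
  \<comment> \<open>An integer product k(k-1) is never negative, so the sign of l can be read off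
    from the equation, as v > 1.\<close>
  have "l * (v - 1) \<ge> 0"
    unfolding eq[symmetric] using nonneg[of x] nonneg[of y] nonneg[of z] by linarith
  then have "l \<ge> 0"
    using assms by (simp add: zero_le_mult_iff)
  moreover have "x \<ge> 0" "y \<ge> 0" "z \<ge> 0"
    using le by (simp_all add: x_def y_def z_def)
  moreover have "real_of_int x < real_of_int v / 2" "real_of_int y < real_of_int v / 2"
      "real_of_int z < real_of_int v / 2"
    unfolding x_def y_def z_def v by simp_all
  moreover have "propus_parameter_set v x y y z l"
    unfolding propus_parameter_set_def GS_parameter_set_def
    using calculation eq assms by (auto simp: l_def)
  ultimately show ?thesis
    by blast
qed

end
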